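(* Let $\mathcal{M}$ be a multset of an affine integer cone $\mathcal{C}\subseteq \mathbb{N}^d$. Assume $\mathcal{M}=\{\mathbf{n}_1, \ldots, \mathbf{n}_d\}\sqcup \{\mathbf{m}_1,\ldots,\mathbf{m}_r\}$, where $\{\mathbf{n}_1, \ldots, \mathbf{n}_d\}$ is a set of extremal rays of $\mathcal{C}$, and define $S=(\mathcal{M}+\mathcal{C})\cup \{\mathbf{0}\}$. Then $S$ has maximal embedding dimension if and only if for all $i,j\in \{1,\ldots,r\}$ there exist $k\in \{1,\ldots,d\}$ and $\mathbf{m}\in \mathcal{M}$ such that $\mathbf{m}\leq_{\mathcal{C}}\mathbf{m}_i+\mathbf{m}_j-\mathbf{n}_k$.
   Context: $\mathbb{N}$ denotes the nonnegative integers. An affine integer cone in $\mathbb{N}^d$ is a set $\mathcal{C}=\mathrm{cone}(B)\cap\mathbb{N}^d$ with $B\subset\mathbb{N}^d$ finite, where $\mathrm{cone}(B)$ is the set of nonnegative rational linear combinations of elements of $B$. A set of extremal rays of $\mathcal{C}$ is a finite set $B'\subseteq\mathcal{C}$ with $\mathrm{cone}(B')=\mathrm{cone}(\mathcal{C})$ such that no proper subset of $B'$ has this property (its elements need not be the smallest lattice points on their rays). Write $\mathbf{x}\le_{\mathcal{C}}\mathbf{y}$ if $\mathbf{y}-\mathbf{x}\in\mathcal{C}$. A multset of $\mathcal{C}$ is a subset $\mathcal{M}\subseteq\mathcal{C}$ that is an antichain with respect to $\le_{\mathcal{C}}$ and contains a set of extremal rays of $\mathcal{C}$. For sets, $A+B=\{\mathbf{a}+\mathbf{b}\mid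 \mathbf{a}\in A,\mathbf{b}\in B\}$. For an affine semigroup $S$ (finitely generated submonoid of $\mathbb{N}^d$), $\mathrm{msg}(S)$ denotes its unique minimal set of generators. The set $E$ of minimal extremal rays of $S$ consists, for each extremal ray (half-line) of $\mathrm{cone}(S)$, of the smallest nonzero element of $S$ on that half-line. For nonempty $X\subseteq S$, the Apéry set is $\operatorname{Ap}(S,X)=\{\mathbf{s}\in S\mid \mathbf{s}-\mathbf{x}\notin S\text{ for all }\mathbf{x}\in X\}$. $S$ has maximal embedding dimension if $\mathrm{msg}(S)\setminus E=\operatorname{Ap}(S,E)\setminus\{\mathbf{0}\}$, where $E$ is the set of minimal extremal rays of $S$. *)

theory Defs
  imports "HOL-Analysis.Finite_Cartesian_Product" "HOL-Library.Set_Algebras" "HOL.Hull"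
begin

text \<open>
  All vectors live in the rational space \<^typ>\<open>rat ^ 'd\<close>; the lattice points with nonnegative
  coordinates are the subset \<open>nat_vecs\<close>. Differences such as \<open>y - x\<close> are therefore genuine
  (not truncated), and the rational cone needs no embedding. The dimension is \<open>CARD('d)\<close>.
\<close>

definition nat_vecs :: "(rat ^ 'd) set" where
  "nat_vecs = {x. \<forall>i. x $ i \<in> \<nat>}"

text \<open>The generating set may be infinite; each combination uses finitely many elements.\<close>

definition rat_cone :: "(rat ^ 'd) set \<Rightarrow> (rat ^ 'd) set" where
  "rat_cone B = {x. \<exists>F c. finite F \<and> F \<subseteq> B \<and> (\<forall>b\<in>F. 0 \<le> c b) \<and> x = (\<Sum>b\<in>F. c b *s b)}"

definition affine_integer_cone :: "(rat ^ 'd) set \<Rightarrow> bool" where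
  "affine_integer_cone C \<longleftrightarrow> (\<exists>B. finite B \<and> B \<subseteq> nat_vecs \<and> C = rat_cone B \<inter> nat_vecs)"

definition is_extremal_ray_set :: "(rat ^ 'd) set \<Rightarrow> (rat ^ 'd) set \<Rightarrow> bool" where
  "is_extremal_ray_set C R \<longleftrightarrow>
     finite R \<and> R \<subseteq> C \<and> rat_cone R = rat_cone C \<and> (\<forall>R'. R' \<subset> R \<longrightarrow> rat_cone R' \<noteq> rat_cone C)"

definition cone_le :: "(rat ^ 'd) set \<Rightarrow> rat ^ 'd \<Rightarrow> rat ^ 'd \<Rightarrow> bool" where
  "cone_le C x y \<longleftrightarrow> y - x \<in> C"

definition multset :: "(rat ^ 'd) set \<Rightarrow> (rat ^ 'd) set \<Rightarrow> bool" where
  "multset C M \<longleftrightarrow>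
     M \<subseteq> C \<and> (\<forall>x\<in>M. \<forall>y\<in>M. cone_le C x y \<longrightarrow> x = y) \<and> (\<exists>R\<subseteq>M. is_extremal_ray_set C R)"

definition is_submonoid :: "(rat ^ 'd) set \<Rightarrow> bool" where
  "is_submonoid T \<longleftrightarrow> 0 \<in> T \<and> (\<forall>x\<in>T. \<forall>y\<in>T. x + y \<in> T)"

definition affine_semigroup :: "(rat ^ 'd) set \<Rightarrow> bool" where
  "affine_semigroup S \<longleftrightarrow> (\<exists>A. finite A \<and> A \<subseteq> nat_vecs \<and> S = is_submonoid hull A)"

text \<open>
  For an affine semigroup the inclusion-minimal generating set exists and is unique, so the
  description is proper; for other sets the value is unspecified.
\<close>

definition msg :: "(rat ^ 'd) set \<Rightarrow> (rat ^ 'd) set" where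
  "msg S = (THE A. is_submonoid hull A = S \<and> (\<forall>A'. A' \<subset> A \<longrightarrow> is_submonoid hull A' \<noteq> S))"

definition half_line :: "rat ^ 'd \<Rightarrow> (rat ^ 'd) set" where
  "half_line v = {t *s v | t. 0 \<le> t}"

text \<open>Extremal rays as one-dimensional faces of a cone \<open>K\<close>.\<close>

definition extremal_half_line :: "(rat ^ 'd) set \<Rightarrow> (rat ^ 'd) set \<Rightarrow> bool" where
  "extremal_half_line K \<rho> \<longleftrightarrow>
     (\<exists>v\<in>K. v \<noteq> 0 \<and> \<rho> = half_line v) \<and>
     (\<forall>x\<in>K. \<forall>y\<in>K. x + y \<in> \<rho> \<longrightarrow> x \<in> \<rho> \<and> y \<in> \<rho>)"

text \<open>
  The order \<open>e \<le> x\<close> is the coordinatewise one; it is total on a half-line inside the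
  nonnegative orthant.
\<close>

definition minimal_extremal_rays :: "(rat ^ 'd) set \<Rightarrow> (rat ^ 'd) set" where
  "minimal_extremal_rays S =
     {e. \<exists>\<rho>. extremal_half_line (rat_cone S) \<rho> \<and>
             e \<in> S \<inter> \<rho> - {0} \<and> (\<forall>x\<in>S \<inter> \<rho> - {0}. e \<le> x)}"

definition Apery :: "(rat ^ 'd) set \<Rightarrow> (rat ^ 'd) set \<Rightarrow> (rat ^ 'd) set" where
  "Apery S X = {s\<in>S. \<forall>x\<in>X. s - x \<notin> S}"

text \<open>The notion concerns affine semigroups, so being one is part of the predicate.\<close>

definition maximal_embedding_dimension :: "(rat ^ 'd) set \<Rightarrow> bool" where
  "maximal_embedding_dimension S \<longleftrightarrow>
     affine_semigroup S \<and>
     msg S - minimal_extremal_rays S = Apery S (minimal_extremal_rays S) - {0}"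

end

theory Submission
  imports Defs
begin

text \<open>
  The nonzero elements of \<open>S\<close> are the elements of \<open>C\<close> above some element of \<open>M\<close>, a set closed under
  translation by \<open>C\<close>. This makes all ingredients of maximal embedding dimension explicit.

  A submonoid of \<open>\<nat>\<^sup>d\<close> has as unique minimal generating set its nonzero elements that are not sums of
  two nonzero elements (\<open>msg_eq_indecomposables\<close>). The extremal half-lines of a cone with irredundant
  generators \<open>R\<close> are the half-lines spanned by \<open>R\<close> (\<open>extremal_half_line_iff\<close>), and the antichain
  condition leaves a ray generator as the only element of \<open>M\<close> on its half-line, so
  \<open>minimal_extremal_rays S\<close> is \<open>R\<close> itself. Finally \<open>S\<close> is an affine semigroup: a sum \<open>x + c\<close> with
  \<open>x \<in> M\<close> and \<open>c \<in> C\<close> can be indecomposable only if \<open>c\<close> lies in a bounded box, since otherwise a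
  generator can be split off \<open>c\<close>.

  An indecomposable element outside \<open>R\<close> always lies in \<open>Apery S R\<close>, so maximal embedding dimension
  says that every sum \<open>s\<close> of two nonzero elements of \<open>S\<close> satisfies \<open>s - b \<in> S\<close> for some \<open>b \<in> R\<close>.
  It is enough to check this on sums of two elements of \<open>M\<close>, because \<open>s - b \<in> M + C\<close>
  survives translation of \<open>s\<close> by \<open>C\<close>, and on elements of \<open>M - R\<close>, because it is immediate when a summand is in \<open>R\<close>.
  There \<open>s - b\<close> is never zero, again by the antichain condition, so it lies in \<open>M + C\<close>, which is the
  stated inequality.
\<close>

section \<open>Lattice points with nonnegative coordinates\<close>

lemma zero_in_nat_vecs: "0 \<in> nat_vecs"
  by (simp add: nat_vecs_def)

lemma nat_vecs_add: "x \<in> nat_vecs \<Longrightarrow> y \<in> nat_vecs \<Longrightarrow> x + y \<in> nat_vecs"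
  by (simp add: nat_vecs_def)

lemma nat_vecs_nonneg: "x \<in> nat_vecs \<Longrightarrow> 0 \<le> x"
  by (auto simp: nat_vecs_def less_eq_vec_def Nats_altdef2)

lemma nat_vecs_diff:
  assumes "x \<in> nat_vecs" "y \<in> nat_vecs" "0 \<le> x - y"
  shows "x - y \<in> nat_vecs"
  using assms by (auto simp: nat_vecs_def less_eq_vec_def Nats_altdef2)

lemma nonneg_vec_add_eq_0_iff:
  fixes x y :: "rat ^ 'd"
  assumes "0 \<le> x" "0 \<le> y"
  shows "x + y = 0 \<longleftrightarrow> x = 0 \<and> y = 0"
  using assms by (auto simp: less_eq_vec_def vec_eq_iff add_nonneg_eq_0_iff)

text \<open>The sum of coordinates makes \<open>nat_vecs\<close> well founded under removal of nonzero summands.\<close>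

definition coordinate_sum :: "rat ^ 'd \<Rightarrow> nat" where
  "coordinate_sum x = nat \<lfloor>\<Sum>i\<in>UNIV. x $ i\<rfloor>"

lemma of_nat_coordinate_sum:
  assumes "x \<in> nat_vecs"
  shows "of_nat (coordinate_sum x) = (\<Sum>i\<in>UNIV. x $ i)"
proof -
  have "\<forall>i. \<exists>k. x $ i = rat_of_nat k"
    using assms by (auto simp: nat_vecs_def elim: Nats_cases)
  then obtain f where "\<forall>i. x $ i = rat_of_nat (f i)" by metis
  then have "(\<Sum>i\<in>UNIV. x $ i) = of_nat (\<Sum>i\<in>UNIV. f i)" by simp
  then show ?thesis by (simp only: coordinate_sum_def floor_of_nat nat_int)
qed

lemma coordinate_sum_less:
  assumes "x \<in> nat_vecs" "y \<in> nat_vecs" "y \<noteq> 0"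
  shows "coordinate_sum x < coordinate_sum (x + y)"
proof -
  have nonneg: "\<forall>i. 0 \<le> y $ i"
    using nat_vecs_nonneg[OF assms(2)] by (simp add: less_eq_vec_def)
  then have "(\<Sum>i\<in>UNIV. y $ i) \<noteq> 0"
    using assms(3) by (subst sum_nonneg_eq_0_iff) (auto simp: vec_eq_iff)
  then have "0 < (\<Sum>i\<in>UNIV. y $ i)"
    using nonneg by (simp add: less_le sum_nonneg)
  then have "rat_of_nat (coordinate_sum x) < of_nat (coordinate_sum (x + y))"
    using assms by (simp add: of_nat_coordinate_sum nat_vecs_add sum.distrib)
  then show ?thesis by simp
qed

lemma finite_nat_vecs_le: "finite {x \<in> nat_vecs. x \<le> (u :: rat ^ 'd)}"
proof -
  have "finite {k. rat_of_nat k \<le> u $ i}" for i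
  proof (rule finite_subset)
    show "{k. rat_of_nat k \<le> u $ i} \<subseteq> {..nat \<lfloor>u $ i\<rfloor>}"
    proof
      fix k assume "k \<in> {k. rat_of_nat k \<le> u $ i}"
      then have "int k \<le> \<lfloor>u $ i\<rfloor>" by (simp add: le_floor_iff)
      then show "k \<in> {..nat \<lfloor>u $ i\<rfloor>}" by simp
    qed
  qed simp
  then have "finite (PiE UNIV (\<lambda>i. {k. rat_of_nat k \<le> u $ i}))"
    by (intro finite_PiE) simp_all
  moreover have "{x \<in> nat_vecs. x \<le> u} \<subseteq>
      (\<lambda>f. \<chi> i. rat_of_nat (f i)) ` PiE UNIV (\<lambda>i. {k. rat_of_nat k \<le> u $ i})"
  proof
    fix x assume "x \<in> {x \<in> nat_vecs. x \<le> u}"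
    then have "\<forall>i. \<exists>k. x $ i = rat_of_nat k" and le: "\<forall>i. x $ i \<le> u $ i"
      by (simp_all add: nat_vecs_def less_eq_vec_def) (metis Nats_cases)
    then obtain f where f: "\<forall>i. x $ i = rat_of_nat (f i)" by metis
    then have "x = (\<chi> i. rat_of_nat (f i))" by (simp add: vec_eq_iff)
    with f le show "x \<in> (\<lambda>f. \<chi> i. rat_of_nat (f i)) ` PiE UNIV (\<lambda>i. {k. rat_of_nat k \<le> u $ i})"
      by (intro image_eqI[of _ _ f]) auto
  qed
  ultimately show ?thesis by (blast intro: finite_subset)
qed

section \<open>Minimal generators of a submonoid\<close>

definition indecomposables :: "(rat ^ 'd) set \<Rightarrow> (rat ^ 'd) set" where
  "indecomposables S = {s \<in> S - {0}. \<forall>a\<in>S - {0}. \<forall>b\<in>S - {0}. s \<noteq> a + b}"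

lemma is_submonoid_hull: "is_submonoid (is_submonoid hull A)"
  by (rule hull_in) (auto simp: is_submonoid_def)

lemma zero_in_submonoid_hull: "0 \<in> is_submonoid hull A"
  using is_submonoid_hull is_submonoid_def by blast

lemma submonoid_hull_add:
  "x \<in> is_submonoid hull A \<Longrightarrow> y \<in> is_submonoid hull A \<Longrightarrow> x + y \<in> is_submonoid hull A"
  using is_submonoid_hull is_submonoid_def by blast

text \<open>Decomposing repeatedly terminates because the summands have smaller coordinate sums.\<close>

lemma hull_indecomposables:
  assumes S: "is_submonoid S" and "S \<subseteq> nat_vecs"
  shows "is_submonoid hull (indecomposables S) = S"
proof
  show "is_submonoid hull indecomposables S \<subseteq> S"
    using S by (intro hull_minimal) (auto simp: indecomposables_def)
  let ?H = "is_submonoid hull indecomposables S"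
  have "s \<in> S \<Longrightarrow> s \<in> ?H" for s
  proof (induction s rule: measure_induct_rule[where f = coordinate_sum])
    case (less s)
    consider "s = 0" | "s \<in> indecomposables S"
      | a b where "a \<in> S - {0}" "b \<in> S - {0}" "s = a + b"
      using less.prems by (auto simp: indecomposables_def)
    then show ?case
    proof cases
      case 1
      then show ?thesis by (simp add: zero_in_submonoid_hull)
    next
      case 2
      then show ?thesis by (rule hull_inc)
    next
      case 3
      then have "coordinate_sum a < coordinate_sum s" "coordinate_sum b < coordinate_sum s"
        using assms(2) coordinate_sum_less[of a b] coordinate_sum_less[of b a]
        by (auto simp: add.commute)
      then have "a \<in> ?H" "b \<in> ?H" using 3 less.IH by auto
      then show ?thesis using 3 submonoid_hull_add by blast
    qed
  qed
  then show "S \<subseteq> ?H" by blast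
qed

text \<open>
  Removing an indecomposable element from a submonoid leaves a submonoid, so a set of generators
  cannot do without it. This also makes the minimal generating set unique.
\<close>

lemma indecomposables_subset_generators:
  assumes "is_submonoid hull A = S"
  shows "indecomposables S \<subseteq> A"
proof
  fix s assume s: "s \<in> indecomposables S"
  show "s \<in> A"
  proof (rule ccontr)
    assume "s \<notin> A"
    have "is_submonoid S" using assms is_submonoid_hull by blast
    moreover have "x + y \<noteq> s" if "x \<in> S - {s}" "y \<in> S - {s}" for x y
      using s that by (cases "x = 0 \<or> y = 0") (auto simp: indecomposables_def)
    ultimately have "is_submonoid (S - {s})"
      using s by (auto simp: is_submonoid_def indecomposables_def)
    moreover have "A \<subseteq> S - {s}"
      using assms \<open>s \<notin> A\<close> hull_subset[of A is_submonoid] by auto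
    ultimately have "S \<subseteq> S - {s}" using assms hull_minimal by blast
    then show False using s by (auto simp: indecomposables_def)
  qed
qed

lemma msg_eq_indecomposables:
  assumes "is_submonoid S" "S \<subseteq> nat_vecs"
  shows "msg S = indecomposables S"
  unfolding msg_def
proof (rule the_equality)
  show "is_submonoid hull indecomposables S = S \<and>
      (\<forall>A'. A' \<subset> indecomposables S \<longrightarrow> is_submonoid hull A' \<noteq> S)"
    using hull_indecomposables[OF assms] indecomposables_subset_generators by blast
next
  fix A assume "is_submonoid hull A = S \<and> (\<forall>A'. A' \<subset> A \<longrightarrow> is_submonoid hull A' \<noteq> S)"
  then show "A = indecomposables S"
    using hull_indecomposables[OF assms] indecomposables_subset_generators[of A S] by blast
qed

section \<open>Rational cones and their extremal half-lines\<close>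

lemma rat_cone_sum:
  assumes "finite F" "F \<subseteq> B" "\<And>b. b \<in> F \<Longrightarrow> 0 \<le> c b"
  shows "(\<Sum>b\<in>F. c b *s b) \<in> rat_cone B"
  using assms unfolding rat_cone_def by blast

lemma rat_cone_finite_iff:
  assumes "finite R"
  shows "x \<in> rat_cone R \<longleftrightarrow> (\<exists>c. (\<forall>b\<in>R. 0 \<le> c b) \<and> x = (\<Sum>b\<in>R. c b *s b))"
proof
  assume "x \<in> rat_cone R"
  then obtain F c where F: "F \<subseteq> R" and c: "\<forall>b\<in>F. 0 \<le> c b" and x: "x = (\<Sum>b\<in>F. c b *s b)"
    by (auto simp: rat_cone_def)
  let ?c = "\<lambda>b. if b \<in> F then c b else 0"
  have "x = (\<Sum>b\<in>R. ?c b *s b)"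
    unfolding x using assms F by (intro sum.mono_neutral_cong_left) auto
  then show "\<exists>c. (\<forall>b\<in>R. 0 \<le> c b) \<and> x = (\<Sum>b\<in>R. c b *s b)"
    using c by (intro exI[of _ ?c]) simp
qed (use assms rat_cone_sum[of R R] in blast)

lemma rat_cone_mono: "A \<subseteq> B \<Longrightarrow> rat_cone A \<subseteq> rat_cone B"
  unfolding rat_cone_def by blast

lemma rat_cone_finite_support:
  assumes "x \<in> rat_cone B"
  obtains F where "finite F" "F \<subseteq> B" "x \<in> rat_cone F"
  using assms unfolding rat_cone_def by blast

lemma rat_cone_add:
  assumes "x \<in> rat_cone B" "y \<in> rat_cone B"
  shows "x + y \<in> rat_cone B"
proof -
  obtain F G where F: "finite F" "F \<subseteq> B" "x \<in> rat_cone F" and G: "finite G" "G \<subseteq> B" "y \<in> rat_cone G"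
    using assms by (metis rat_cone_finite_support)
  then have "x \<in> rat_cone (F \<union> G)" "y \<in> rat_cone (F \<union> G)"
    using rat_cone_mono by blast+
  moreover have fin: "finite (F \<union> G)" using F G by simp
  ultimately obtain c d where c: "\<forall>b\<in>F \<union> G. 0 \<le> c b" "x = (\<Sum>b\<in>F \<union> G. c b *s b)"
    and d: "\<forall>b\<in>F \<union> G. 0 \<le> d b" "y = (\<Sum>b\<in>F \<union> G. d b *s b)"
    unfolding rat_cone_finite_iff[OF fin] by blast
  have "x + y \<in> rat_cone (F \<union> G)"
    unfolding rat_cone_finite_iff[OF fin] using c d
    by (intro exI[of _ "\<lambda>b. c b + d b"]) (simp add: sum.distrib vector_sadd_rdistrib)
  then show ?thesis using F G rat_cone_mono[of "F \<union> G" B] by blast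
qed

lemma rat_cone_scale:
  assumes "x \<in> rat_cone B" "0 \<le> a"
  shows "a *s x \<in> rat_cone B"
proof -
  obtain F c where "finite F" "F \<subseteq> B" "\<forall>b\<in>F. 0 \<le> c b" "x = (\<Sum>b\<in>F. c b *s b)"
    using assms(1) by (auto simp: rat_cone_def)
  then show ?thesis
    using assms(2) unfolding rat_cone_def
    by (intro CollectI exI[of _ F] exI[of _ "\<lambda>b. a * c b"])
      (simp add: vec_eq_iff sum_distrib_left mult.assoc)
qed

lemma zero_in_rat_cone: "0 \<in> rat_cone B"
  unfolding rat_cone_def by (auto intro: exI[of _ "{}"])

lemma rat_cone_superset: "B \<subseteq> rat_cone B"
proof
  fix b assume "b \<in> B"
  then show "b \<in> rat_cone B"
    unfolding rat_cone_def
    by (intro CollectI exI[of _ "{b}"] exI[of _ "\<lambda>_. 1"]) simp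
qed

lemma rat_cone_least:
  assumes "X \<subseteq> rat_cone B"
  shows "rat_cone X \<subseteq> rat_cone B"
proof
  fix x assume "x \<in> rat_cone X"
  then obtain F c where "finite F" "F \<subseteq> X" "\<forall>b\<in>F. 0 \<le> c b" "x = (\<Sum>b\<in>F. c b *s b)"
    by (auto simp: rat_cone_def)
  moreover have "(\<Sum>b\<in>F. c b *s b) \<in> rat_cone B" if "finite F" "F \<subseteq> X" "\<forall>b\<in>F. 0 \<le> c b"
    using that
  proof (induction F)
    case empty
    then show ?case by (simp add: zero_in_rat_cone)
  next
    case (insert b F)
    then show ?case using assms by (auto intro!: rat_cone_add rat_cone_scale)
  qed
  ultimately show "x \<in> rat_cone B" by simp
qed

lemma rat_cone_remove_generator:
  assumes "finite R" "b \<in> R" "x \<in> rat_cone R"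
  obtains a y where "0 \<le> a" "y \<in> rat_cone (R - {b})" "x = a *s b + y"
proof -
  obtain c where c: "\<forall>b\<in>R. 0 \<le> c b" "x = (\<Sum>b\<in>R. c b *s b)"
    using assms(3) unfolding rat_cone_finite_iff[OF assms(1)] by blast
  have "(\<Sum>b\<in>R - {b}. c b *s b) \<in> rat_cone (R - {b})"
    using assms(1) c(1) by (intro rat_cone_sum) auto
  moreover have "x = c b *s b + (\<Sum>b\<in>R - {b}. c b *s b)"
    using c(2) assms(1,2) by (simp only: sum.remove)
  ultimately show ?thesis using that assms(2) c(1) by blast
qed

lemma rat_cone_nonneg:
  assumes "B \<subseteq> nat_vecs" "x \<in> rat_cone B"
  shows "0 \<le> x"
proof -
  obtain F c where "F \<subseteq> B" "\<forall>b\<in>F. 0 \<le> c b" "x = (\<Sum>b\<in>F. c b *s b)"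
    using assms(2) by (auto simp: rat_cone_def)
  moreover have "\<forall>b\<in>B. \<forall>i. 0 \<le> b $ i"
    using assms(1) nat_vecs_nonneg by (auto simp: less_eq_vec_def)
  ultimately show ?thesis
    by (auto simp: less_eq_vec_def intro!: sum_nonneg mult_nonneg_nonneg)
qed

lemma irredundant_generator:
  assumes "is_extremal_ray_set C R" "b \<in> R"
  shows "b \<notin> rat_cone (R - {b})"
proof
  assume "b \<in> rat_cone (R - {b})"
  then have "R \<subseteq> rat_cone (R - {b})" using rat_cone_superset[of "R - {b}"] by blast
  then have "rat_cone R \<subseteq> rat_cone (R - {b})" by (rule rat_cone_least)
  moreover have "rat_cone (R - {b}) \<subseteq> rat_cone R" by (rule rat_cone_mono) blast
  ultimately have "rat_cone (R - {b}) = rat_cone R" by (rule antisym[rotated])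
  moreover have "R - {b} \<subset> R" using assms(2) by blast
  ultimately show False using assms(1) by (simp add: is_extremal_ray_set_def)
qed

lemma half_line_scale:
  assumes "0 < a"
  shows "half_line (a *s v) = half_line v"
proof -
  have "t *s v \<in> half_line (a *s v)" if "0 \<le> t" for t
    using assms that unfolding half_line_def
    by (intro CollectI exI[of _ "t / a"]) (simp add: vector_smult_assoc)
  moreover have "t *s (a *s v) \<in> half_line v" if "0 \<le> t" for t
    using assms that unfolding half_line_def
    by (intro CollectI exI[of _ "t * a"]) (simp add: vector_smult_assoc)
  ultimately show ?thesis by (auto simp: half_line_def)
qed

lemma self_in_half_line: "v \<in> half_line v"
  unfolding half_line_def by (intro CollectI exI[of _ 1]) simp

text \<open>
  An irredundant generator \<open>b\<close> spans a face: if \<open>x + y\<close> is a multiple of \<open>b\<close>, the contributions of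
  the other generators to \<open>x\<close> and \<open>y\<close> add up to a multiple of \<open>b\<close>. A positive multiple would make
  \<open>b\<close> redundant, and a nonpositive one forces these contributions to vanish because the cone lies in
  the orthant.
\<close>

lemma extremal_half_line_generator:
  assumes "finite R" "R \<subseteq> nat_vecs" "b \<in> R" "b \<notin> rat_cone (R - {b})"
  shows "extremal_half_line (rat_cone R) (half_line b)"
proof -
  have "x \<in> half_line b \<and> y \<in> half_line b"
    if xR: "x \<in> rat_cone R" and yR: "y \<in> rat_cone R" and sum: "x + y \<in> half_line b" for x y
  proof -
    obtain a x' where x: "0 \<le> a" "x' \<in> rat_cone (R - {b})" "x = a *s b + x'"
      by (rule rat_cone_remove_generator[OF assms(1,3) xR])
    obtain a' y' where y: "0 \<le> a'" "y' \<in> rat_cone (R - {b})" "y = a' *s b + y'"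
      by (rule rat_cone_remove_generator[OF assms(1,3) yR])
    obtain t where "x + y = t *s b" using sum by (auto simp: half_line_def)
    then have rest: "x' + y' = (t - a - a') *s b"
      unfolding x y by (simp add: vec_eq_iff algebra_simps)
    have "t - a - a' \<le> 0"
    proof (rule ccontr)
      assume pos: "\<not> t - a - a' \<le> 0"
      then have "b = inverse (t - a - a') *s (x' + y')"
        by (simp add: rest vector_smult_assoc)
      moreover have "inverse (t - a - a') *s (x' + y') \<in> rat_cone (R - {b})"
        using x y pos by (intro rat_cone_scale rat_cone_add) auto
      ultimately show False using assms(4) by simp
    qed
    moreover have nonneg: "0 \<le> b" "0 \<le> x'" "0 \<le> y'"
      using assms x y nat_vecs_nonneg rat_cone_nonneg[of "R - {b}"] by blast+
    ultimately have "\<forall>i. (x' + y') $ i \<le> 0"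
      unfolding rest by (auto simp: less_eq_vec_def intro: mult_nonpos_nonneg)
    then have "x' + y' = 0"
      using nonneg by (auto simp: vec_eq_iff less_eq_vec_def intro: antisym)
    then have "x' = 0" "y' = 0" using nonneg nonneg_vec_add_eq_0_iff by blast+
    then show ?thesis using x y by (auto simp: half_line_def)
  qed
  moreover have "b \<noteq> 0" using assms(4) zero_in_rat_cone by blast
  ultimately show ?thesis
    using assms(3) rat_cone_superset unfolding extremal_half_line_def by blast
qed

lemma extremal_half_line_spanned_by_generator:
  assumes "finite R" "extremal_half_line (rat_cone R) \<rho>"
  obtains b where "b \<in> R" "\<rho> = half_line b"
proof -
  obtain v where v: "v \<in> rat_cone R" "v \<noteq> 0" "\<rho> = half_line v"
    using assms(2) by (auto simp: extremal_half_line_def)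
  obtain c where c: "\<forall>b\<in>R. 0 \<le> c b" "v = (\<Sum>b\<in>R. c b *s b)"
    using v(1) unfolding rat_cone_finite_iff[OF assms(1)] by blast
  obtain b where b: "b \<in> R" "c b *s b \<noteq> 0"
    using c(2) v(2) sum.neutral[of R "\<lambda>b. c b *s b"] by blast
  have "(\<Sum>b\<in>R - {b}. c b *s b) \<in> rat_cone R"
    using assms(1) c(1) by (intro rat_cone_sum) auto
  moreover have "c b *s b \<in> rat_cone R"
    using b(1) c(1) rat_cone_superset by (blast intro: rat_cone_scale)
  moreover have "c b *s b + (\<Sum>b\<in>R - {b}. c b *s b) \<in> \<rho>"
    using self_in_half_line[of v] sum.remove[OF assms(1) b(1), of "\<lambda>b. c b *s b"] c(2) v(3)
    by simp
  ultimately have "c b *s b \<in> \<rho>"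
    using assms(2) unfolding extremal_half_line_def by blast
  then obtain t where t: "0 \<le> t" "c b *s b = t *s v"
    using v(3) by (auto simp: half_line_def)
  moreover have "0 < c b" "0 < t"
    using b c(1) t by (auto simp: less_le)
  ultimately have "\<rho> = half_line b"
    using v(3) half_line_scale[of "c b" b] half_line_scale[of t v] by simp
  then show ?thesis using that b(1) by blast
qed

lemma extremal_half_line_iff:
  assumes "finite R" "R \<subseteq> nat_vecs" "\<And>b. b \<in> R \<Longrightarrow> b \<notin> rat_cone (R - {b})"
  shows "extremal_half_line (rat_cone R) \<rho> \<longleftrightarrow> (\<exists>b\<in>R. \<rho> = half_line b)"
  using extremal_half_line_generator[OF assms(1,2)] assms(3)
    extremal_half_line_spanned_by_generator[OF assms(1), of \<rho>] by blast

section \<open>The semigroup of a finite multset\<close>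

lemma in_translates_iff: "z \<in> M + C \<longleftrightarrow> (\<exists>x\<in>M. cone_le C x z)"
proof
  assume "z \<in> M + C"
  then obtain x c where "x \<in> M" "c \<in> C" "z = x + c"
    by (rule set_plus_elim)
  then show "\<exists>x\<in>M. cone_le C x z" by (intro bexI[of _ x]) (simp_all add: cone_le_def)
next
  assume "\<exists>x\<in>M. cone_le C x z"
  then obtain x where "x \<in> M" "z - x \<in> C" by (auto simp: cone_le_def)
  then have "x + (z - x) \<in> M + C" by (rule set_plus_intro)
  then show "z \<in> M + C" by simp
qed

text \<open>
  Here \<open>R\<close> is the chosen set of extremal rays. The case \<open>R = {}\<close> is the trivial cone \<open>C = {0}\<close>, where
  \<open>M\<close> may contain \<open>0\<close>.
\<close>

locale finite_multset =
  fixes C M R :: "(rat ^ 'd) set"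
  assumes cone: "affine_integer_cone C"
    and ray_set: "is_extremal_ray_set C R"
    and rays_subset: "R \<subseteq> M"
    and subset_cone: "M \<subseteq> C"
    and antichain: "x \<in> M \<Longrightarrow> y \<in> M \<Longrightarrow> cone_le C x y \<Longrightarrow> x = y"
    and finite_M: "finite M"
    and rays_nonempty: "R \<noteq> {}"
begin

definition S :: "(rat ^ 'd) set" where
  "S = (M + C) \<union> {0}"

lemma finite_rays: "finite R"
  using ray_set by (simp add: is_extremal_ray_set_def)

lemma cone_subset_nat_vecs: "C \<subseteq> nat_vecs"
  using cone by (auto simp: affine_integer_cone_def)

lemma rays_subset_nat_vecs: "R \<subseteq> nat_vecs"
  using rays_subset subset_cone cone_subset_nat_vecs by blast

lemma cone_eq: "C = rat_cone R \<inter> nat_vecs"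
proof -
  obtain B where B: "C = rat_cone B \<inter> nat_vecs"
    using cone by (auto simp: affine_integer_cone_def)
  have R: "rat_cone R = rat_cone C" using ray_set by (simp add: is_extremal_ray_set_def)
  have "C \<subseteq> rat_cone C" by (rule rat_cone_superset)
  moreover have "rat_cone C \<subseteq> rat_cone B" using B by (intro rat_cone_least) blast
  ultimately show ?thesis using B R by blast
qed

lemma in_cone_iff: "x \<in> C \<longleftrightarrow> x \<in> rat_cone R \<and> x \<in> nat_vecs"
  using cone_eq by blast

lemma zero_in_cone: "0 \<in> C"
  by (simp add: in_cone_iff zero_in_rat_cone zero_in_nat_vecs)

lemma cone_add: "x \<in> C \<Longrightarrow> y \<in> C \<Longrightarrow> x + y \<in> C"
  by (simp add: in_cone_iff rat_cone_add nat_vecs_add)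

lemma cone_diff:
  assumes "x \<in> C" "y \<in> C" "x - y \<in> rat_cone R"
  shows "x - y \<in> C"
proof -
  have "0 \<le> x - y" using rays_subset_nat_vecs assms(3) by (rule rat_cone_nonneg)
  then show ?thesis using assms by (auto simp: in_cone_iff intro: nat_vecs_diff)
qed

lemma ray_nonzero: "b \<in> R \<Longrightarrow> b \<noteq> 0"
  using irredundant_generator[OF ray_set, of b] by (auto simp: zero_in_rat_cone)

text \<open>Zero is below everything, so an antichain containing it would have no room for a ray.\<close>

lemma multset_nonzero:
  assumes "x \<in> M"
  shows "x \<noteq> 0"
proof
  assume "x = 0"
  obtain b where b: "b \<in> R" using rays_nonempty by blast
  then have "b \<in> M" "cone_le C 0 b" using rays_subset subset_cone by (auto simp: cone_le_def)
  then show False using antichain[of 0 b] assms \<open>x = 0\<close> ray_nonzero[OF b] by simp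
qed

lemma zero_notin_translates: "0 \<notin> M + C"
proof
  assume "0 \<in> M + C"
  then obtain x c where "x \<in> M" "c \<in> C" "x + c = 0"
    by (auto elim!: set_plus_elim)
  moreover from this have "0 \<le> x" "0 \<le> c"
    using subset_cone cone_subset_nat_vecs nat_vecs_nonneg by blast+
  ultimately show False using multset_nonzero nonneg_vec_add_eq_0_iff by blast
qed

lemma S_minus_zero: "S - {0} = M + C"
  using zero_notin_translates by (auto simp: S_def)

lemma translates_add_cone:
  assumes "s \<in> M + C" "c \<in> C"
  shows "s + c \<in> M + C"
proof -
  obtain x d where "x \<in> M" "d \<in> C" "s = x + d"
    using assms(1) by (rule set_plus_elim)
  then show ?thesis
    using assms(2) cone_add set_plus_intro[of x M "d + c" C] by (simp add: add.assoc)
qed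

lemma multset_subset_translates: "M \<subseteq> M + C"
  using zero_in_cone set_plus_intro[of _ M 0 C] by auto

lemma S_subset_cone: "S \<subseteq> C"
  using subset_cone zero_in_cone cone_add by (auto simp: S_def elim!: set_plus_elim)

lemma S_add_cone: "s \<in> M + C \<Longrightarrow> c \<in> C \<Longrightarrow> s + c \<in> S"
  using translates_add_cone by (simp add: S_def)

lemma is_submonoid_S: "is_submonoid S"
proof -
  have "x + y \<in> S" if "x \<in> S" "y \<in> S" for x y
    using that S_add_cone[of x y] S_subset_cone by (auto simp: S_def)
  then show ?thesis by (simp add: is_submonoid_def S_def)
qed

lemma S_subset_nat_vecs: "S \<subseteq> nat_vecs"
  using S_subset_cone cone_subset_nat_vecs by blast

lemma msg_S: "msg S = indecomposables S"
  using is_submonoid_S S_subset_nat_vecs by (rule msg_eq_indecomposables)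

text \<open>
  In a representation of \<open>c\<close> by the generators, one with coefficient larger than 1 can be subtracted
  without leaving the cone. If all coefficients are at most 1, then \<open>c\<close> is at most the sum of the
  generators. This is the step behind Gordan's lemma.
\<close>

lemma cone_split_generator:
  assumes "c \<in> C" "\<not> c \<le> \<Sum>R"
  obtains b where "b \<in> R" "c - b \<in> C"
proof -
  obtain q where q: "\<forall>b\<in>R. 0 \<le> q b" "c = (\<Sum>b\<in>R. q b *s b)"
    using assms(1) unfolding in_cone_iff rat_cone_finite_iff[OF finite_rays] by blast
  have nonneg: "\<forall>b\<in>R. \<forall>i. 0 \<le> b $ i"
    using rays_subset_nat_vecs nat_vecs_nonneg by (auto simp: less_eq_vec_def)
  have "\<exists>b\<in>R. 1 < q b"
  proof (rule ccontr)
    assume "\<not> ?thesis"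
    then have "c $ i \<le> (\<Sum>R) $ i" for i
      using nonneg q(1) unfolding q(2) sum_component
      by (intro sum_mono) (auto simp: not_less intro: mult_left_le_one_le)
    then show False using assms(2) by (simp add: less_eq_vec_def)
  qed
  then obtain b where b: "b \<in> R" "1 < q b" by blast
  have "c - b = (q b - 1) *s b + (\<Sum>b\<in>R - {b}. q b *s b)"
    unfolding q(2) sum.remove[OF finite_rays b(1)]
    by (simp add: vector_sub_rdistrib)
  moreover have "(q b - 1) *s b \<in> rat_cone R"
    using b rat_cone_superset by (intro rat_cone_scale) auto
  moreover have "(\<Sum>b\<in>R - {b}. q b *s b) \<in> rat_cone R"
    using finite_rays q(1) by (intro rat_cone_sum) auto
  ultimately have "c - b \<in> C"
    using assms(1) b(1) rays_subset subset_cone by (intro cone_diff) (auto intro: rat_cone_add)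
  then show ?thesis using that b(1) by blast
qed

text \<open>
  If \<open>c - b \<in> C\<close> for a ray generator \<open>b\<close>, then \<open>x + c = b + (x + (c - b))\<close> is a decomposition in \<open>S\<close>.
  As the box is finite, this makes \<open>S\<close> finitely generated.
\<close>

lemma indecomposables_bounded: "indecomposables S \<subseteq> M + {c \<in> nat_vecs. c \<le> \<Sum>R}"
proof
  fix s assume s: "s \<in> indecomposables S"
  then have "s \<in> M + C" using S_minus_zero by (auto simp: indecomposables_def)
  then obtain x c where xc: "x \<in> M" "c \<in> C" "s = x + c"
    by (auto elim!: set_plus_elim)
  have "c \<le> \<Sum>R"
  proof (rule ccontr)
    assume "\<not> c \<le> \<Sum>R"
    then obtain b where b: "b \<in> R" "c - b \<in> C"
      by (rule cone_split_generator[OF xc(2)])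
    then have "b \<in> S - {0}" "x + (c - b) \<in> S - {0}"
      using xc(1) rays_subset multset_subset_translates
      by (auto simp: S_minus_zero)
    moreover have "s = b + (x + (c - b))" using xc(3) by simp
    ultimately show False using s unfolding indecomposables_def by blast
  qed
  then show "s \<in> M + {c \<in> nat_vecs. c \<le> \<Sum>R}"
    using xc cone_subset_nat_vecs by (auto intro: set_plus_intro)
qed

lemma affine_semigroup_S: "affine_semigroup S"
  unfolding affine_semigroup_def
proof (intro exI conjI)
  show "finite (indecomposables S)"
    using indecomposables_bounded finite_M finite_nat_vecs_le
    by (blast intro: finite_subset finite_set_plus)
  show "indecomposables S \<subseteq> nat_vecs"
    using S_subset_nat_vecs by (auto simp: indecomposables_def)
  show "S = is_submonoid hull indecomposables S"
    using hull_indecomposables is_submonoid_S S_subset_nat_vecs by blast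
qed

lemma rat_cone_S: "rat_cone S = rat_cone R"
proof
  show "rat_cone S \<subseteq> rat_cone R"
    using S_subset_cone in_cone_iff by (intro rat_cone_least) blast
  show "rat_cone R \<subseteq> rat_cone S"
    using rays_subset multset_subset_translates by (intro rat_cone_mono) (auto simp: S_def)
qed

text \<open>
  The elements of \<open>C\<close> on a half-line are totally ordered by \<open>cone_le C\<close>, since the difference of two
  of them is a lattice point that is, up to sign, on the same half-line. An antichain contains at
  most one of them.
\<close>

lemma multset_on_ray:
  assumes "b \<in> R" "x \<in> M" "x \<in> half_line b"
  shows "x = b"
proof -
  obtain t where t: "0 \<le> t" "x = t *s b" using assms(3) by (auto simp: half_line_def)
  have b: "b \<in> M" "b \<in> C" "x \<in> C" "b \<in> rat_cone R"
    using assms rays_subset subset_cone rat_cone_superset by blast+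
  show ?thesis
  proof (cases "t \<le> 1")
    case True
    have "b - x = (1 - t) *s b" using t by (simp add: vec_eq_iff algebra_simps)
    then have "b - x \<in> C" using True b by (intro cone_diff) (auto intro: rat_cone_scale)
    then show ?thesis using antichain assms(2) b by (auto simp: cone_le_def)
  next
    case False
    have "x - b = (t - 1) *s b" using t by (simp add: vec_eq_iff algebra_simps)
    then have "x - b \<in> C" using False b by (intro cone_diff) (auto intro: rat_cone_scale)
    then show ?thesis using antichain[of b x] assms(2) b by (auto simp: cone_le_def)
  qed
qed

text \<open>
  If \<open>x + c\<close> with \<open>x \<in> M\<close> and \<open>c \<in> C\<close> is on an extremal half-line, so is \<open>x\<close>, and then \<open>x\<close> is the
  ray generator.
\<close>

lemma ray_below_S:
  assumes "b \<in> R" "s \<in> S \<inter> half_line b - {0}"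
  shows "b \<le> s"
proof -
  have "s \<in> M + C" using assms(2) S_minus_zero by blast
  then obtain x c where xc: "x \<in> M" "c \<in> C" "s = x + c"
    by (auto elim!: set_plus_elim)
  have "extremal_half_line (rat_cone R) (half_line b)"
    using extremal_half_line_generator irredundant_generator[OF ray_set] finite_rays
      rays_subset_nat_vecs assms(1) by blast
  moreover have "x \<in> rat_cone R" "c \<in> rat_cone R" "x + c \<in> half_line b"
    using xc subset_cone in_cone_iff assms(2) by blast+
  ultimately have "x \<in> half_line b" unfolding extremal_half_line_def by blast
  then have "x = b" using multset_on_ray assms(1) xc(1) by blast
  moreover have "0 \<le> c" using xc(2) cone_subset_nat_vecs nat_vecs_nonneg by blast
  ultimately show ?thesis using xc(3) by (simp add: less_eq_vec_def)
qed

text \<open>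
  The ray generators are the minimal extremal rays although they need not be primitive lattice
  points: smaller points of \<open>C\<close> on the same half-line do not belong to \<open>S\<close>.
\<close>

lemma minimal_extremal_rays_S: "minimal_extremal_rays S = R"
proof -
  have ray: "b \<in> S \<inter> half_line b - {0}" if "b \<in> R" for b
    using that rays_subset multset_subset_translates self_in_half_line ray_nonzero[OF that]
    by (auto simp: S_def)
  have "(e \<in> S \<inter> half_line b - {0} \<and> (\<forall>x\<in>S \<inter> half_line b - {0}. e \<le> x)) \<longleftrightarrow> e = b"
    if "b \<in> R" for b e
    using that ray[OF that] ray_below_S[OF that] by (blast intro: antisym)
  moreover have "extremal_half_line (rat_cone S) \<rho> \<longleftrightarrow> (\<exists>b\<in>R. \<rho> = half_line b)" for \<rho>
    using extremal_half_line_iff[OF finite_rays rays_subset_nat_vecs]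
      irredundant_generator[OF ray_set] by (simp add: rat_cone_S)
  ultimately have "e \<in> minimal_extremal_rays S \<longleftrightarrow> (\<exists>b\<in>R. e = b)" for e
    unfolding minimal_extremal_rays_def mem_Collect_eq by metis
  then show ?thesis by blast
qed

text \<open>An element \<open>b + (s - b)\<close> with \<open>s - b \<in> S\<close> is decomposable unless it equals \<open>b\<close>.\<close>

lemma indecomposables_subset_Apery: "indecomposables S - R \<subseteq> Apery S R - {0}"
proof
  fix s assume s: "s \<in> indecomposables S - R"
  have "s - b \<notin> S" if "b \<in> R" for b
  proof
    assume "s - b \<in> S"
    moreover have "s - b \<noteq> 0" using s that by auto
    moreover have "b \<in> S - {0}"
      using that rays_subset multset_subset_translates by (auto simp: S_minus_zero)
    moreover have "s = b + (s - b)" by simp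
    ultimately show False using s unfolding indecomposables_def by blast
  qed
  then show "s \<in> Apery S R - {0}" using s by (auto simp: Apery_def indecomposables_def)
qed

lemma maximal_embedding_dimension_S_iff:
  "maximal_embedding_dimension S \<longleftrightarrow> (\<forall>s\<in>M + C. \<forall>t\<in>M + C. \<exists>b\<in>R. s + t - b \<in> S)"
proof -
  have "maximal_embedding_dimension S \<longleftrightarrow> Apery S R - {0} \<subseteq> indecomposables S - R"
    using affine_semigroup_S indecomposables_subset_Apery
    by (auto simp: maximal_embedding_dimension_def msg_S minimal_extremal_rays_S)
  also have "\<dots> \<longleftrightarrow> (\<forall>s\<in>S - {0}. (\<forall>b\<in>R. s - b \<notin> S) \<longrightarrow> s \<in> indecomposables S)"
  proof -
    \<comment> \<open>An element of \<open>R\<close> is never in the Apery set, because subtracting it from itself gives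
      \<open>0 \<in> S\<close>; so subtracting \<open>R\<close> on the right changes nothing.\<close>
    have "s \<notin> R" if "\<forall>b\<in>R. s - b \<notin> S" for s
      using that by (auto simp: S_def)
    then show ?thesis by (auto simp: Apery_def)
  qed
  also have "\<dots> \<longleftrightarrow> (\<forall>s\<in>S - {0}. \<forall>t\<in>S - {0}. \<exists>b\<in>R. s + t - b \<in> S)"
  proof (intro iffI ballI impI)
    fix s t
    assume irred: "\<forall>u\<in>S - {0}. (\<forall>b\<in>R. u - b \<notin> S) \<longrightarrow> u \<in> indecomposables S"
      and st: "s \<in> S - {0}" "t \<in> S - {0}"
    have "s + t \<in> S - {0}"
      using st translates_add_cone[of s t] S_subset_cone unfolding S_minus_zero[symmetric] by blast
    moreover have "s + t \<notin> indecomposables S" using st by (auto simp: indecomposables_def)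
    ultimately show "\<exists>b\<in>R. s + t - b \<in> S" using irred by metis
  next
    fix u
    assume "\<forall>s\<in>S - {0}. \<forall>t\<in>S - {0}. \<exists>b\<in>R. s + t - b \<in> S"
      and "u \<in> S - {0}" and "\<forall>b\<in>R. u - b \<notin> S"
    then show "u \<in> indecomposables S" unfolding indecomposables_def by fast
  qed
  finally show ?thesis by (simp only: S_minus_zero)
qed

text \<open>
  If \<open>x \<in> R\<close>, then \<open>b = x\<close> removes it from \<open>(x + c) + (y + d)\<close> and leaves \<open>y + (c + d)\<close>, so only
  elements of \<open>M - R\<close> have to be tested; the summands from \<open>C\<close> do no harm.
\<close>

lemma maximal_embedding_dimension_S_iff_multset:
  "maximal_embedding_dimension S \<longleftrightarrow> (\<forall>x\<in>M - R. \<forall>y\<in>M - R. \<exists>b\<in>R. x + y - b \<in> M + C)"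
proof
  assume med: "maximal_embedding_dimension S"
  show "\<forall>x\<in>M - R. \<forall>y\<in>M - R. \<exists>b\<in>R. x + y - b \<in> M + C"
  proof (intro ballI)
    fix x y assume xy: "x \<in> M - R" "y \<in> M - R"
    then obtain b where b: "b \<in> R" "x + y - b \<in> S"
      using med multset_subset_translates unfolding maximal_embedding_dimension_S_iff by blast
    have "x + y \<noteq> b"
    proof
      assume "x + y = b"
      then have "cone_le C x b" using xy subset_cone by (auto simp: cone_le_def)
      then show False using antichain xy b(1) rays_subset by blast
    qed
    then show "\<exists>b\<in>R. x + y - b \<in> M + C" using b by (auto simp: S_def)
  qed
next
  assume test: "\<forall>x\<in>M - R. \<forall>y\<in>M - R. \<exists>b\<in>R. x + y - b \<in> M + C"
  show "maximal_embedding_dimension S"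
    unfolding maximal_embedding_dimension_S_iff
  proof (intro ballI)
    fix s t assume "s \<in> M + C" "t \<in> M + C"
    then obtain x c y d where s: "s = x + c" "x \<in> M" "c \<in> C" and t: "t = y + d" "y \<in> M" "d \<in> C"
      by (auto elim!: set_plus_elim)
    have cd: "c + d \<in> C" using s t cone_add by blast
    have xy: "x \<in> M + C" "y \<in> M + C" using s t multset_subset_translates by blast+
    consider "x \<in> R" | "y \<in> R" | "x \<in> M - R" "y \<in> M - R" using s t by blast
    then show "\<exists>b\<in>R. s + t - b \<in> S"
    proof cases
      case 1
      have "s + t - x = y + (c + d)" using s t by simp
      then show ?thesis using 1 S_add_cone[OF xy(2) cd] by metis
    next
      case 2
      have "s + t - y = x + (c + d)" using s t by simp
      then show ?thesis using 2 S_add_cone[OF xy(1) cd] by metis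
    next
      case 3
      then obtain b where b: "b \<in> R" "x + y - b \<in> M + C" using test by blast
      have "s + t - b = (x + y - b) + (c + d)" using s t by simp
      then show ?thesis using b S_add_cone[OF b(2) cd] by metis
    qed
  qed
qed

end

section \<open>The characterisation of maximal embedding dimension\<close>

theorem theorem4p1:
  fixes C M S :: "(rat ^ 'd) set"
    and n :: "'d \<Rightarrow> rat ^ 'd"
    and m :: "nat \<Rightarrow> rat ^ 'd"
    and r :: nat
  assumes "affine_integer_cone C"
    and "multset C M"
    and "inj n"
    and "inj_on m {1..r}"
    and "M = range n \<union> m ` {1..r}"
    and "range n \<inter> m ` {1..r} = {}"
    and "is_extremal_ray_set C (range n)"
    and "S = (M + C) \<union> {0}"
  shows "maximal_embedding_dimension S \<longleftrightarrow>
    (\<forall>i\<in>{1..r}. \<forall>j\<in>{1..r}. \<exists>k. \<exists>x\<in>M. cone_le C x (m i + m j - n k))"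
proof -
  interpret fm: finite_multset C M "range n"
  proof
    show "affine_integer_cone C" by fact
    show "is_extremal_ray_set C (range n)" by fact
    show "range n \<subseteq> M" "finite M" "range n \<noteq> {}" using assms(5) by simp_all
    show "M \<subseteq> C" using assms(2) by (simp add: multset_def)
    show "x = y" if "x \<in> M" "y \<in> M" "cone_le C x y" for x y
      using assms(2) that unfolding multset_def by blast
  qed
  have S: "S = fm.S" using assms(8) by (simp add: fm.S_def)
  have rest: "M - range n = m ` {1..r}" using assms(5,6) by blast
  show ?thesis
    unfolding S fm.maximal_embedding_dimension_S_iff_multset rest by (simp add: in_translates_iff)
qed

end
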